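(* Let $d$, $m$ and $r$ be integers with $d \ge 3$ and $r \ge 3$, let $G$ be an $r$-regular bipartite graph and let $M$ be a distance $d$ matching in $G$ with $|M| = m$. If $(r,d) \neq (3,3)$ and $(r,d) \neq (3,4)$, then there exist $\min\{\lambda_c(G), mr\}$ edge-disjoint odd ears of $V(M)$ in $G$.
   Context: All graphs are finite and simple. $V(M)$ is the set of endvertices of the edges of $M$. A set $F$ of edges of a graph $G$ is a cyclic edge cut if $G-F$ has two components each of which contains a cycle. The cyclic edge-connectivity $\lambda_c(G)$ is the size of a minimum cyclic edge cut of $G$; if $G$ has no cyclic edge cut, $\lambda_c(G)=\infty$. The distance between two edges $e,f$ is the length of a shortest path joining an endvertex of $e$ and an endvertex of $f$. A matching $M$ is a distance $d$ matching if the distance between each pair of distinct edges of $M$ is at least $d$. For $U \subseteq V(G)$, an ear of $U$ is either a path having both endvertices but no internal vertices in $U$, or a cycle having exactly one vertex in $U$ (in particular, every edge joining two vertices of $U$ is an ear of $U$). An ear is odd if it contains an odd number of edges. *)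

theory Defs
  imports Main "HOL-Library.Extended_Nat"
begin

text \<open>A graph is given by its vertex set \<open>V\<close> and its edge set \<open>E\<close>, edges being two-element
  sets of vertices.\<close>

definition simple_graph :: "'a set \<Rightarrow> 'a set set \<Rightarrow> bool" where
  "simple_graph V E \<longleftrightarrow> finite V \<and> (\<forall>e\<in>E. e \<subseteq> V \<and> card e = 2)"

definition regular :: "'a set \<Rightarrow> 'a set set \<Rightarrow> nat \<Rightarrow> bool" where
  "regular V E r \<longleftrightarrow> (\<forall>v\<in>V. card {e \<in> E. v \<in> e} = r)"

definition bipartite :: "'a set \<Rightarrow> 'a set set \<Rightarrow> bool" where
  "bipartite V E \<longleftrightarrow>
     (\<exists>A B. A \<union> B = V \<and> A \<inter> B = {} \<and> (\<forall>e\<in>E. \<exists>a\<in>A. \<exists>b\<in>B. e = {a, b}))"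

text \<open>Paths and cycles are written as lists of vertices; the first vertex of a cycle is repeated
  at the end. The number of edges of either is \<open>length (walk_edges p)\<close>.\<close>

fun walk_edges :: "'a list \<Rightarrow> 'a set list" where
  "walk_edges (u # v # p) = {u, v} # walk_edges (v # p)"
| "walk_edges _ = []"

definition is_walk :: "'a set \<Rightarrow> 'a set set \<Rightarrow> 'a list \<Rightarrow> bool" where
  "is_walk V E p \<longleftrightarrow> p \<noteq> [] \<and> set p \<subseteq> V \<and> set (walk_edges p) \<subseteq> E"

definition is_path :: "'a set \<Rightarrow> 'a set set \<Rightarrow> 'a list \<Rightarrow> bool" where
  "is_path V E p \<longleftrightarrow> is_walk V E p \<and> distinct p"

definition is_cycle :: "'a set \<Rightarrow> 'a set set \<Rightarrow> 'a list \<Rightarrow> bool" where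
  "is_cycle V E p \<longleftrightarrow>
     is_walk V E p \<and> hd p = last p \<and> distinct (tl p) \<and> length (walk_edges p) \<ge> 3"

text \<open>Components are represented by their vertex sets.\<close>

definition component :: "'a set \<Rightarrow> 'a set set \<Rightarrow> 'a set \<Rightarrow> bool" where
  "component V E C \<longleftrightarrow>
     (\<exists>v\<in>V. C = {u. \<exists>p. is_path V E p \<and> hd p = v \<and> last p = u})"

definition cyclic_edge_cut :: "'a set \<Rightarrow> 'a set set \<Rightarrow> 'a set set \<Rightarrow> bool" where
  "cyclic_edge_cut V E F \<longleftrightarrow>
     F \<subseteq> E \<and>
     (\<exists>C D. component V (E - F) C \<and> component V (E - F) D \<and> C \<noteq> D \<and>
        (\<exists>c. is_cycle V (E - F) c \<and> set c \<subseteq> C) \<and>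
        (\<exists>c. is_cycle V (E - F) c \<and> set c \<subseteq> D))"

text \<open>In \<open>enat\<close> the infimum of the empty set is \<open>\<infinity>\<close>. This gives the intended value when there is
  no cyclic edge cut, and likewise infinite distance between edges of different components.\<close>

definition cyclic_edge_connectivity :: "'a set \<Rightarrow> 'a set set \<Rightarrow> enat" where
  "cyclic_edge_connectivity V E = Inf {enat (card F) | F. cyclic_edge_cut V E F}"

definition edge_distance :: "'a set \<Rightarrow> 'a set set \<Rightarrow> 'a set \<Rightarrow> 'a set \<Rightarrow> enat" where
  "edge_distance V E e f =
     Inf {enat (length (walk_edges p)) | p. is_path V E p \<and> hd p \<in> e \<and> last p \<in> f}"

definition matching :: "'a set set \<Rightarrow> 'a set set \<Rightarrow> bool" where
  "matching E M \<longleftrightarrow> M \<subseteq> E \<and> pairwise disjnt M"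

definition distance_matching :: "'a set \<Rightarrow> 'a set set \<Rightarrow> nat \<Rightarrow> 'a set set \<Rightarrow> bool" where
  "distance_matching V E d M \<longleftrightarrow>
     matching E M \<and> (\<forall>e\<in>M. \<forall>f\<in>M. e \<noteq> f \<longrightarrow> enat d \<le> edge_distance V E e f)"

definition ear :: "'a set \<Rightarrow> 'a set set \<Rightarrow> 'a set \<Rightarrow> 'a list \<Rightarrow> bool" where
  "ear V E U p \<longleftrightarrow>
     (is_path V E p \<and> hd p \<in> U \<and> last p \<in> U \<and> set (butlast (tl p)) \<inter> U = {}) \<or>
     (is_cycle V E p \<and> card (set p \<inter> U) = 1)"

definition odd_ear :: "'a set \<Rightarrow> 'a set set \<Rightarrow> 'a set \<Rightarrow> 'a list \<Rightarrow> bool" where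
  "odd_ear V E U p \<longleftrightarrow> ear V E U p \<and> odd (length (walk_edges p))"

text \<open>An odd ear has at least one edge, so distinct members of an edge-disjoint set of odd ears
  are distinct as subgraphs, although one subgraph may be traversed by several lists.\<close>

definition edge_disjoint :: "'a list set \<Rightarrow> bool" where
  "edge_disjoint P \<longleftrightarrow> pairwise (\<lambda>p q. disjnt (set (walk_edges p)) (set (walk_edges q))) P"

end

theory Submission
  imports Defs
begin

text \<open>Let \<open>A\<close>, \<open>B\<close> be the colour classes, \<open>S = \<Union>M \<inter> A\<close> and \<open>T = \<Union>M \<inter> B\<close>. By parity, every
  path from \<open>S\<close> to \<open>T\<close> contains an odd ear of \<open>\<Union>M\<close>, so by Menger's theorem it suffices that
  every edge cut between \<open>X \<supseteq> S\<close> and \<open>V - X \<supseteq> T\<close> has at least \<open>min \<lambda>\<^sub>c (m r)\<close> edges. If both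
  sides contain a cycle, the cut is a cyclic edge cut. If one side, say \<open>X\<close>, is acyclic, then it
  induces at most \<open>card X\<close> edges, so at least \<open>(r - 2) * card X\<close> edges leave it. The distance
  condition makes \<open>X\<close> large compared with \<open>S\<close>, up to leaves and isolated vertices, which can be
  deleted, so this is at least \<open>m r\<close>.\<close>

section \<open>Walks, paths and cycles\<close>

lemma length_walk_edges: "length (walk_edges p) = length p - 1"
  by (induction p rule: walk_edges.induct) auto

lemma walk_edges_subset_iff:
  "set (walk_edges p) \<subseteq> E \<longleftrightarrow> successively (\<lambda>u v. {u, v} \<in> E) p"
  by (induction p rule: walk_edges.induct) auto

lemma walk_edges_subset_set: "e \<in> set (walk_edges p) \<Longrightarrow> e \<subseteq> set p"
  by (induction p rule: walk_edges.induct) auto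

lemma walk_edges_append:
  "walk_edges (p @ x # q) = walk_edges (p @ [x]) @ walk_edges (x # q)"
  by (induction p rule: walk_edges.induct) auto

text \<open>Cutting out the stretch between two visits to one vertex shortens the list. The length
  bound serves distance estimates; the set inclusion keeps the result inside a given vertex
  set.\<close>

lemma successively_distinct:
  assumes "p \<noteq> []" "successively R p"
  shows "\<exists>q. q \<noteq> [] \<and> distinct q \<and> successively R q \<and> hd q = hd p \<and> last q = last p
           \<and> length q \<le> length p \<and> set q \<subseteq> set p"
  using assms
proof (induction "length p" arbitrary: p rule: less_induct)
  case less
  show ?case
  proof (cases "distinct p")
    case True
    then show ?thesis using less.prems by blast
  next
    case False
    then obtain xs ys zs y where p: "p = xs @ [y] @ ys @ [y] @ zs"
      using not_distinct_decomp by blast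
    let ?p = "xs @ y # zs"
    have "successively R ?p"
      using less.prems(2) unfolding p by (auto simp: successively_append_iff successively_Cons)
    moreover have "length ?p < length p" "?p \<noteq> []" "hd ?p = hd p" "last ?p = last p"
      "set ?p \<subseteq> set p"
      unfolding p by (auto simp: hd_append)
    ultimately show ?thesis using less.hyps[of ?p] by fastforce
  qed
qed

lemma rtrancl_imp_distinct_chain:
  assumes "(a, b) \<in> {(u, v). R u v}\<^sup>*"
  shows "\<exists>p. p \<noteq> [] \<and> distinct p \<and> successively R p \<and> hd p = a \<and> last p = b"
proof -
  have "\<exists>p. p \<noteq> [] \<and> successively R p \<and> hd p = a \<and> last p = b"
    using assms
  proof (induction rule: rtrancl_induct)
    case base
    show ?case by (rule exI[of _ "[a]"]) auto
  next
    case (step y z)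
    then obtain p where "p \<noteq> []" "successively R p" "hd p = a" "last p = y" by blast
    with step.hyps(2) show ?case
      by (intro exI[of _ "p @ [z]"]) (auto simp: successively_append_iff)
  qed
  then show ?thesis using successively_distinct by metis
qed

section \<open>Induced edges and acyclic vertex sets\<close>

definition induced :: "'a set set \<Rightarrow> 'a set \<Rightarrow> 'a set set" where
  "induced E X = {e \<in> E. e \<subseteq> X}"

lemma induced_Diff_singleton:
  assumes "finite E"
  shows "card (induced E X) =
    card (induced E (X - {x})) + card {e \<in> induced E X. x \<in> e}"
proof -
  have "induced E X = induced E (X - {x}) \<union> {e \<in> induced E X. x \<in> e}"
    unfolding induced_def by auto
  moreover have "induced E (X - {x}) \<inter> {e \<in> induced E X. x \<in> e} = {}"
    unfolding induced_def by auto
  moreover have "finite (induced E X)" "finite (induced E (X - {x}))"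
    using assms unfolding induced_def by auto
  ultimately show ?thesis by (metis (lifting) card_Un_disjoint finite_Un)
qed

lemma simple_graph_finite_edges: "simple_graph V E \<Longrightarrow> finite E"
  unfolding simple_graph_def by (meson Pow_iff finite_Pow_iff finite_subset subsetI)

lemma simple_graph_edgeD:
  assumes "simple_graph V E" "{u, v} \<in> E"
  shows "u \<in> V" "v \<in> V" "u \<noteq> v"
  using assms unfolding simple_graph_def by force+

lemma walk_subset_vertices:
  assumes "simple_graph V E" "successively (\<lambda>u v. {u, v} \<in> E) p" "p \<noteq> []" "hd p \<in> V"
  shows "set p \<subseteq> V"
  using assms(2-)
proof (induction p rule: walk_edges.induct)
  case (1 u v p)
  then have "v \<in> V" using simple_graph_edgeD[OF assms(1)] by auto
  with 1 show ?case by auto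
qed auto

lemma simple_graph_neighbour:
  assumes "simple_graph V E" "e \<in> E" "x \<in> e"
  shows "\<exists>y. e = {x, y}"
proof -
  obtain a b where "e = {a, b}"
    using assms unfolding simple_graph_def by (metis card_2_iff)
  with assms(3) show ?thesis by auto
qed

text \<open>In a simple graph at most one edge at \<open>x\<close> leads to \<open>b\<close>, so a
  second edge inside \<open>X\<close> has another end.\<close>

lemma other_neighbour:
  assumes G: "simple_graph V E" and "card {e \<in> induced E X. x \<in> e} \<ge> 2"
  shows "\<exists>y\<in>X. y \<noteq> b \<and> {x, y} \<in> E"
proof -
  have "\<exists>e. e \<in> induced E X \<and> x \<in> e \<and> e \<noteq> {x, b}"
  proof (rule ccontr)
    assume "\<not> ?thesis"
    then have "{e \<in> induced E X. x \<in> e} \<subseteq> {{x, b}}" by auto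
    then have "card {e \<in> induced E X. x \<in> e} \<le> 1"
      by (metis card.empty card_insert_disjoint card_mono finite.intros One_nat_def empty_iff)
    with assms(2) show False by simp
  qed
  then obtain e where e: "e \<in> E" "e \<subseteq> X" "x \<in> e" "e \<noteq> {x, b}"
    unfolding induced_def by auto
  then obtain y where "e = {x, y}" using simple_graph_neighbour[OF G] by blast
  with e show ?thesis by auto
qed

text \<open>The first vertex of a longest path in \<open>X\<close> has all its neighbours from
  \<open>X\<close> on the path; one other than its successor closes a cycle.\<close>

lemma min_degree_2_imp_cycle:
  assumes G: "simple_graph V E" and X: "X \<subseteq> V" "X \<noteq> {}"
    and deg: "\<And>x. x \<in> X \<Longrightarrow> card {e \<in> induced E X. x \<in> e} \<ge> 2"
  shows "\<exists>c. is_cycle V E c \<and> set c \<subseteq> X"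
proof -
  have finX: "finite X" using G X unfolding simple_graph_def by (meson finite_subset)
  let ?Q = "\<lambda>p. p \<noteq> [] \<and> distinct p \<and> set p \<subseteq> X \<and> set (walk_edges p) \<subseteq> E"
  obtain x0 where "x0 \<in> X" using X by auto
  then have "?Q [x0]" by simp
  moreover have "\<forall>p. ?Q p \<longrightarrow> length p < Suc (card X)"
    using finX by (metis card_mono distinct_card le_imp_less_Suc)
  ultimately obtain p where p: "?Q p" and max: "\<And>q. ?Q q \<Longrightarrow> length q \<le> length p"
    using ex_has_greatest_nat[of ?Q "[x0]" length "Suc (card X)"] by (metis (no_types, lifting) less_imp_le)
  obtain x q where pq: "p = x # q" using p by (cases p) auto
  have x: "x \<in> X" using p pq by auto
  obtain y where y: "y \<in> X" "y \<noteq> hd q" "{x, y} \<in> E"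
    using other_neighbour[OF G deg[OF x]] by blast
  have yx: "y \<noteq> x" using simple_graph_edgeD[OF G y(3)] by simp
  have "y \<in> set p"
  proof (rule ccontr)
    assume "y \<notin> set p"
    then have "?Q (y # p)" using p y pq by (auto simp: insert_commute)
    from max[OF this] show False by simp
  qed
  then have "y \<in> set q" using pq yx by auto
  then obtain p1 p2 where q: "q = p1 @ y # p2" by (meson split_list)
  \<comment> \<open>Avoiding \<open>hd q\<close> pays off here: the cycle closed by \<open>y\<close>
    has at least three edges.\<close>
  have "p1 \<noteq> []" using q y(2) by auto
  let ?c = "y # x # p1 @ [y]"
  have "set (walk_edges (x # p1 @ [y])) \<subseteq> E"
    using p unfolding pq q using walk_edges_append[of "x # p1" y p2] by auto
  then have "is_walk V E ?c"
    using p y X unfolding is_walk_def pq q by (auto simp: insert_commute)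
  moreover have "length (walk_edges ?c) \<ge> 3"
    using \<open>p1 \<noteq> []\<close> by (cases p1) (auto simp: length_walk_edges)
  moreover have "distinct (tl ?c)" using p unfolding pq q by auto
  ultimately have "is_cycle V E ?c" unfolding is_cycle_def by auto
  moreover have "set ?c \<subseteq> X" using p unfolding pq q by auto
  ultimately show ?thesis by blast
qed

text \<open>An acyclic nonempty set has a vertex of degree at most 1; deleting it loses at most one
  edge and exactly one vertex.\<close>

lemma card_induced_acyclic:
  assumes G: "simple_graph V E" and "X \<subseteq> V"
    and "\<nexists>c. is_cycle V E c \<and> set c \<subseteq> X"
  shows "card (induced E X) \<le> card X"
  using assms(2,3)
proof (induction "card X" arbitrary: X rule: less_induct)
  case less
  have finX: "finite X" using G less.prems unfolding simple_graph_def by (meson finite_subset)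
  show ?case
  proof (cases "X = {}")
    case True
    then have "induced E X = {}" using G unfolding simple_graph_def induced_def by fastforce
    then show ?thesis by simp
  next
    case False
    then obtain x where x: "x \<in> X" "card {e \<in> induced E X. x \<in> e} < 2"
      using min_degree_2_imp_cycle[OF G less.prems(1)] less.prems(2) by (meson not_less)
    have "card (X - {x}) < card X" using x(1) finX by (meson card_Diff1_less)
    then have "card (induced E (X - {x})) \<le> card (X - {x})"
      using less.hyps[of "X - {x}"] less.prems by blast
    with \<open>card (X - {x}) < card X\<close> x(2) show ?thesis
      using induced_Diff_singleton[OF simple_graph_finite_edges[OF G], of X x] by linarith
  qed
qed

section \<open>Cuts\<close>

definition cut :: "'a set set \<Rightarrow> 'a set \<Rightarrow> 'a set set" where
  "cut E X = {e \<in> E. e \<inter> X \<noteq> {} \<and> \<not> e \<subseteq> X}"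

lemma cut_complement:
  assumes "simple_graph V E"
  shows "cut E (V - X) = cut E X"
  using assms unfolding simple_graph_def cut_def by fastforce

text \<open>Incidences between \<open>X\<close> and \<open>E\<close> are counted twice: by
  regularity each vertex of \<open>X\<close> contributes \<open>r\<close>, while a cut edge
  contributes 1 and an induced edge 2.\<close>

lemma card_cut:
  assumes G: "simple_graph V E" and reg: "regular V E r" and "X \<subseteq> V"
  shows "card (cut E X) + 2 * card (induced E X) = r * card X"
proof -
  have fin: "finite E" "finite X"
    using simple_graph_finite_edges[OF G] G assms(3) unfolding simple_graph_def
    by (auto dest: finite_subset)
  have card2: "card e = 2" if "e \<in> E" for e using G that unfolding simple_graph_def by auto
  have "r * card X = (\<Sum>x\<in>X. card {e \<in> E. x \<in> e})"
    using reg assms(3) unfolding regular_def by (simp add: subset_iff)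
  also have "\<dots> = (\<Sum>x\<in>X. \<Sum>e\<in>E. of_bool (x \<in> e))"
    using fin by (simp add: Int_def)
  also have "\<dots> = (\<Sum>e\<in>E. \<Sum>x\<in>X. of_bool (x \<in> e))" by (rule sum.swap)
  also have "\<dots> = (\<Sum>e\<in>E. card (e \<inter> X))"
    using fin by (simp add: Int_def conj_commute)
  also have "\<dots> = (\<Sum>e\<in>E. of_bool (e \<in> cut E X) + 2 * of_bool (e \<in> induced E X))"
  proof (rule sum.cong[OF refl])
    fix e assume e: "e \<in> E"
    obtain a b where "e = {a, b}" "a \<noteq> b" using card2[OF e] by (meson card_2_iff)
    then show "card (e \<inter> X) = of_bool (e \<in> cut E X) + 2 * of_bool (e \<in> induced E X)"
      using e unfolding cut_def induced_def by auto
  qed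
  also have "\<dots> = card (E \<inter> cut E X) + 2 * card (E \<inter> induced E X)"
    using fin by (simp add: sum.distrib flip: sum_distrib_left)
  moreover have "E \<inter> cut E X = cut E X" "E \<inter> induced E X = induced E X"
    unfolding cut_def induced_def by auto
  ultimately show ?thesis by simp
qed

section \<open>The edge bound for acyclic sets\<close>

lemma card_ge_disjoint_family:
  assumes "finite X" "\<And>w. w \<in> W \<Longrightarrow> N w \<subseteq> X \<and> card (N w) = c"
    and "\<And>w w'. w \<in> W \<Longrightarrow> w' \<in> W \<Longrightarrow> w \<noteq> w' \<Longrightarrow> N w \<inter> N w' = {}"
    and "finite W"
  shows "c * card W \<le> card X"
proof -
  have "c * card W = (\<Sum>w\<in>W. card (N w))" using assms(2) by simp
  also have "\<dots> = card (\<Union>w\<in>W. N w)"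
    using assms by (intro card_UN_disjoint[symmetric]) (auto intro: finite_subset)
  also have "\<dots> \<le> card X" using assms by (intro card_mono) auto
  finally show ?thesis .
qed

text \<open>Deleting from \<open>X\<close> a vertex outside \<open>W\<close> of degree at most 1, or an isolated vertex of
  \<open>W\<close>, preserves the inequality. Once neither exists, every vertex of \<open>W\<close> has two (three if
  \<open>d \<ge> 5\<close>) private vertices within distance two, which bounds \<open>card W\<close>.\<close>

lemma acyclic_edge_bound:
  assumes G: "simple_graph V E" and r: "r \<ge> 3" and d: "d \<ge> 3" "r \<ge> 4 \<or> d \<ge> 5"
    and "X \<subseteq> V" "W \<subseteq> X" and "\<nexists>c. is_cycle V E c \<and> set c \<subseteq> X"
    and "\<And>p. successively (\<lambda>u v. {u, v} \<in> E) p \<Longrightarrow> p \<noteq> [] \<Longrightarrow> hd p \<in> W \<Longrightarrow> last p \<in> W \<Longrightarrow>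
           hd p \<noteq> last p \<Longrightarrow> d < length p"
  shows "r * card W + 2 * card (induced E X) \<le> r * card X"
  using assms(5-)
proof (induction "card X" arbitrary: X W rule: less_induct)
  case less
  \<comment> \<open>\<open>length\<close> counts vertices, so \<open>d < length p\<close> means at
    least \<open>d\<close> edges. The walks range over all of \<open>E\<close>, hence the condition
    survives deletions from \<open>X\<close> and \<open>W\<close>.\<close>
  note far = less.prems(4)
  have finX: "finite X" using G less.prems unfolding simple_graph_def by (meson finite_subset)
  have finW: "finite W" using finX less.prems(2) by (rule rev_finite_subset)
  have finE: "finite E" using G by (rule simple_graph_finite_edges)
  consider (leaf) x where "x \<in> X" "x \<notin> W" "card {e \<in> induced E X. x \<in> e} \<le> 1"
    | (isolated) x where "x \<in> W" "card {e \<in> induced E X. x \<in> e} = 0"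
    | (dense) "\<And>x. x \<in> X - W \<Longrightarrow> \<not> card {e \<in> induced E X. x \<in> e} \<le> 1"
        "\<And>x. x \<in> W \<Longrightarrow> card {e \<in> induced E X. x \<in> e} \<noteq> 0"
    by blast
  then show ?case
  proof cases
    case leaf
    \<comment> \<open>At most one induced edge is lost: the left side drops by at most 2, the right
      side by \<open>r\<close>, which is at least 3.\<close>
    have cX: "card X = Suc (card (X - {x}))" using card_Suc_Diff1[OF finX leaf(1)] by simp
    have "r * card W + 2 * card (induced E (X - {x})) \<le> r * card (X - {x})"
    proof (rule less.hyps)
      show "card (X - {x}) < card X" using cX by simp
      show "X - {x} \<subseteq> V" "W \<subseteq> X - {x}" "\<nexists>c. is_cycle V E c \<and> set c \<subseteq> X - {x}"
        using less.prems(1-3) leaf by blast+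
    qed (rule far)
    with leaf(3) r show ?thesis
      using induced_Diff_singleton[OF finE, of X x] unfolding cX by simp
  next
    case isolated
    \<comment> \<open>No induced edge is lost, so both sides drop by exactly
      \<open>r\<close>.\<close>
    have x: "x \<in> X" using isolated less.prems by auto
    have cX: "card X = Suc (card (X - {x}))" using card_Suc_Diff1[OF finX x] by simp
    have cW: "card W = Suc (card (W - {x}))" using card_Suc_Diff1[OF finW isolated(1)] by simp
    have "r * card (W - {x}) + 2 * card (induced E (X - {x})) \<le> r * card (X - {x})"
    proof (rule less.hyps)
      show "card (X - {x}) < card X" using cX by simp
      show "X - {x} \<subseteq> V" "W - {x} \<subseteq> X - {x}" "\<nexists>c. is_cycle V E c \<and> set c \<subseteq> X - {x}"
        using less.prems(1-3) by blast+
    qed (rule far, auto)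
    with isolated(2) show ?thesis
      using induced_Diff_singleton[OF finE, of X x] unfolding cX cW by simp
  next
    case dense
    have "\<exists>n. n \<in> X \<and> {w, n} \<in> E" if "w \<in> W" for w
    proof -
      have "{e \<in> induced E X. w \<in> e} \<noteq> {}" using dense(2)[OF that] by (metis card.empty)
      then obtain e where "e \<in> E" "e \<subseteq> X" "w \<in> e" unfolding induced_def by blast
      then show ?thesis using simple_graph_neighbour[OF G] by blast
    qed
    then obtain n where n: "\<And>w. w \<in> W \<Longrightarrow> n w \<in> X \<and> {w, n w} \<in> E" by metis
    have nw: "w \<noteq> n w" if "w \<in> W" for w using n[OF that] simple_graph_edgeD[OF G] by metis
    have nW: "n w \<notin> W" if "w \<in> W" for w
      using far[of "[w, n w]"] n[OF that] nw[OF that] that d by auto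
    have nn: "n w \<noteq> n w'" if "w \<in> W" "w' \<in> W" "w \<noteq> w'" for w w'
      using far[of "[w, n w, w']"] n[OF that(1)] n[OF that(2)] that d
      by (auto simp: insert_commute)
    \<comment> \<open>This suffices, since the acyclic set \<open>X\<close> induces at most
      \<open>card X\<close> edges.\<close>
    have "r * card W \<le> (r - 2) * card X"
    proof (cases "r \<ge> 4")
      case True
      \<comment> \<open>The pairs \<open>{w, n w}\<close> are disjoint, and \<open>r\<close> is at
        most \<open>2 * (r - 2)\<close> once \<open>r\<close> is at least 4.\<close>
      have "2 * card W \<le> card X"
        by (rule card_ge_disjoint_family[of _ _ "\<lambda>w. {w, n w}"])
          (use finX finW n nw nW nn less.prems(2) in \<open>auto simp: subset_iff\<close>)
      then have "(r - 2) * (2 * card W) \<le> (r - 2) * card X" by (rule mult_le_mono2)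
      moreover have "r * card W \<le> (r - 2) * (2 * card W)"
        unfolding mult.assoc[symmetric] using True by (intro mult_le_mono1) simp
      ultimately show ?thesis by (rule order_trans[rotated])
    next
      case False
      with d have d5: "d \<ge> 5" by simp
      \<comment> \<open>For \<open>r = 3\<close> each \<open>w\<close> needs three private vertices.
        As \<open>n w\<close> lies outside \<open>W\<close>, it has degree at least 2 in
        \<open>X\<close> and so a neighbour other than \<open>w\<close>.\<close>
      have "\<exists>k. k \<in> X \<and> k \<noteq> w \<and> {n w, k} \<in> E" if "w \<in> W" for w
      proof -
        have "card {e \<in> induced E X. n w \<in> e} \<ge> 2"
          using dense(1)[of "n w"] n[OF that] nW[OF that] by simp
        from other_neighbour[OF G this, of w] show ?thesis by blast
      qed
      then obtain k where k: "\<And>w. w \<in> W \<Longrightarrow> k w \<in> X \<and> k w \<noteq> w \<and> {n w, k w} \<in> E"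
        by metis
      have nk: "n w \<noteq> k w" if "w \<in> W" for w
        using k[OF that] simple_graph_edgeD[OF G] by metis
      have kW: "k w \<notin> W" if "w \<in> W" for w
        using far[of "[w, n w, k w]"] n[OF that] k[OF that] that d by auto
      have nk': "n w \<noteq> k w'" if "w \<in> W" "w' \<in> W" "w \<noteq> w'" for w w'
        using far[of "[w, n w, n w', w']"] n[OF that(1)] n[OF that(2)] k[OF that(2)] that d5
        by (auto simp: insert_commute)
      \<comment> \<open>A common \<open>k w\<close> would give a walk with four edges between
        \<open>w\<close> and \<open>w'\<close>; this is where \<open>d = 4\<close> would
        fail.\<close>
      have kk: "k w \<noteq> k w'" if "w \<in> W" "w' \<in> W" "w \<noteq> w'" for w w'
        using far[of "[w, n w, k w, n w', w']"] n[OF that(1)] n[OF that(2)] k[OF that(1)]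
          k[OF that(2)] that d5 by (auto simp: insert_commute)
      have "3 * card W \<le> card X"
      proof (rule card_ge_disjoint_family[of _ _ "\<lambda>w. {w, n w, k w}"])
        fix w assume w: "w \<in> W"
        show "{w, n w, k w} \<subseteq> X \<and> card {w, n w, k w} = 3"
          using w n[OF w] k[OF w] nw[OF w] nk[OF w] less.prems(2) by auto
      next
        fix w w' assume w: "w \<in> W" "w' \<in> W" "w \<noteq> w'"
        then show "{w, n w, k w} \<inter> {w', n w', k w'} = {}"
          using nW kW nn[OF w] kk[OF w] nk'[OF w] nk'[OF w(2,1)] by auto
      qed (use finX finW in auto)
      moreover have "r = 3" using False r by simp
      ultimately show ?thesis by simp
    qed
    moreover have "card (induced E X) \<le> card X"
      using card_induced_acyclic[OF G] less.prems by blast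
    moreover have "(r - 2) * card X + 2 * card X = r * card X"
    proof -
      have "r - 2 + 2 = r" using r by simp
      then show ?thesis by (metis add_mult_distrib)
    qed
    ultimately show ?thesis by linarith
  qed
qed

section \<open>Cyclic edge cuts from cycles on both sides\<close>

lemma cycle_subset_component:
  assumes "is_cycle V E c"
  shows "\<exists>C. component V E C \<and> set c \<subseteq> C \<and> hd c \<in> C \<and>
    (\<forall>u\<in>C. \<exists>p. is_path V E p \<and> hd p = hd c \<and> last p = u)"
proof -
  let ?C = "{u. \<exists>p. is_path V E p \<and> hd p = hd c \<and> last p = u}"
  have c: "c \<noteq> []" "set c \<subseteq> V" "successively (\<lambda>u v. {u, v} \<in> E) c"
    using assms unfolding is_cycle_def is_walk_def by (auto simp: walk_edges_subset_iff)
  have sub: "set c \<subseteq> ?C"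
  proof
    fix u assume "u \<in> set c"
    then obtain p q where pq: "c = p @ u # q" by (meson split_list)
    let ?p = "p @ [u]"
    have "successively (\<lambda>u v. {u, v} \<in> E) ?p"
      using c(3) unfolding pq by (auto simp: successively_append_iff)
    moreover have "hd ?p = hd c" "set ?p \<subseteq> V" using c unfolding pq by (auto simp: hd_append)
    moreover obtain q' where "q' \<noteq> []" "distinct q'" "successively (\<lambda>u v. {u, v} \<in> E) q'"
      "hd q' = hd ?p" "last q' = last ?p" "set q' \<subseteq> set ?p"
      using successively_distinct[of ?p "\<lambda>u v. {u, v} \<in> E"] calculation(1) by blast
    ultimately have "is_path V E q' \<and> hd q' = hd c \<and> last q' = u"
      unfolding is_path_def is_walk_def walk_edges_subset_iff by auto
    then show "u \<in> ?C" by blast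
  qed
  have "component V E ?C" unfolding component_def using c by (auto intro!: bexI[of _ "hd c"])
  moreover have "hd c \<in> ?C" using sub c(1) by (meson hd_in_set subsetD)
  ultimately show ?thesis using sub by blast
qed

lemma walk_avoiding_cut:
  assumes "successively (\<lambda>u v. {u, v} \<in> E - cut E X) p" "p \<noteq> []" "hd p \<in> X"
  shows "last p \<in> X"
  using assms by (induction p rule: walk_edges.induct) (auto simp: cut_def)

lemma cyclic_edge_cut_cut:
  assumes G: "simple_graph V E"
    and "is_cycle V E c" "set c \<subseteq> X" and "is_cycle V E c'" "set c' \<subseteq> V - X"
  shows "cyclic_edge_cut V E (cut E X)"
proof -
  have cyc: "is_cycle V (E - cut E X) b"
    if "is_cycle V E b" "set b \<subseteq> X \<or> set b \<subseteq> V - X" for b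
  proof -
    have "e \<notin> cut E X" if "e \<in> set (walk_edges b)" for e
      using walk_edges_subset_set[OF that] \<open>set b \<subseteq> X \<or> set b \<subseteq> V - X\<close> unfolding cut_def by auto
    then show ?thesis using that(1) unfolding is_cycle_def is_walk_def by auto
  qed
  \<comment> \<open>\<open>component\<close> hides its base vertex. Knowing that \<open>C\<close> is
    reached from \<open>hd c\<close> confines it to \<open>X\<close>, while \<open>D\<close>
    contains a vertex outside \<open>X\<close>.\<close>
  obtain C where C: "component V (E - cut E X) C" "set c \<subseteq> C" "hd c \<in> C"
    "\<And>u. u \<in> C \<Longrightarrow> \<exists>p. is_path V (E - cut E X) p \<and> hd p = hd c \<and> last p = u"
    using cycle_subset_component[OF cyc[OF assms(2)]] assms(3) by blast
  obtain D where D: "component V (E - cut E X) D" "set c' \<subseteq> D" "hd c' \<in> D"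
    using cycle_subset_component[OF cyc[OF assms(4)]] assms(5) by blast
  have hd: "hd c \<in> X" "hd c' \<notin> X"
    using assms(2-5) unfolding is_cycle_def is_walk_def by (meson hd_in_set subsetD DiffD2)+
  have "C \<subseteq> X"
  proof
    fix u assume "u \<in> C"
    then obtain p where "is_path V (E - cut E X) p" "hd p = hd c" "last p = u" using C(4) by blast
    then show "u \<in> X"
      using walk_avoiding_cut[of E X p] hd(1) unfolding is_path_def is_walk_def walk_edges_subset_iff
      by auto
  qed
  then have "C \<noteq> D" using hd D(3) by auto
  moreover have "cut E X \<subseteq> E" unfolding cut_def by auto
  moreover have "is_cycle V (E - cut E X) c" "is_cycle V (E - cut E X) c'"
    using cyc assms by blast+
  ultimately show ?thesis
    unfolding cyclic_edge_cut_def using C(1,2) D(1,2) by meson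
qed

section \<open>Unit flows and Menger's theorem\<close>

text \<open>Skew symmetry turns the upper bound 1 into the lower bound -1, so an undirected edge
  carries at most one unit, in one direction.\<close>

definition unit_flow :: "'a set set \<Rightarrow> ('a \<Rightarrow> 'a \<Rightarrow> int) \<Rightarrow> bool" where
  "unit_flow E f \<longleftrightarrow> (\<forall>u v. f v u = - f u v) \<and> (\<forall>u v. f u v \<le> 1) \<and>
     (\<forall>u v. {u, v} \<notin> E \<longrightarrow> f u v = 0)"

text \<open>The sign convention is net outflow: sources have positive excess.\<close>

definition excess :: "'a set \<Rightarrow> ('a \<Rightarrow> 'a \<Rightarrow> int) \<Rightarrow> 'a \<Rightarrow> int" where
  "excess V f v = (\<Sum>u\<in>V. f v u)"

fun path_flow :: "'a list \<Rightarrow> 'a \<Rightarrow> 'a \<Rightarrow> int" where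
  "path_flow (a # b # p) u v =
     of_bool (u = a \<and> v = b) - of_bool (u = b \<and> v = a) + path_flow (b # p) u v"
| "path_flow _ u v = 0"

lemma path_flow_skew: "path_flow p v u = - path_flow p u v"
proof (induction p rule: walk_edges.induct)
  case (1 a b p)
  show ?case unfolding path_flow.simps 1 by (simp add: conj_commute)
qed auto

text \<open>A distinct list traverses each edge once, so nothing cancels, and the sign records the
  direction in which \<open>R\<close> holds. \<open>R\<close> will be either residual capacity or
  positive flow.\<close>

lemma path_flow_cases:
  assumes "distinct p" "successively R p"
  shows "if {u, v} \<in> set (walk_edges p)
    then path_flow p u v = 1 \<and> R u v \<or> path_flow p u v = - 1 \<and> R v u
    else path_flow p u v = 0"
  using assms
proof (induction p rule: walk_edges.induct)
  case (1 a b p)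
  have "{a, b} \<notin> set (walk_edges (b # p))"
    using 1(2) walk_edges_subset_set[of "{a, b}" "b # p"] by auto
  then show ?case using 1 by (auto simp: doubleton_eq_iff insert_commute split: if_splits)
qed auto

lemma excess_path_flow:
  assumes "finite V" "set p \<subseteq> V" "p \<noteq> []"
  shows "excess V (path_flow p) v = of_bool (v = hd p) - of_bool (v = last p)"
  using assms(2,3)
proof (induction p rule: walk_edges.induct)
  case (1 a b p)
  have "(\<Sum>u\<in>V. of_bool (v = a \<and> u = b) - of_bool (v = b \<and> u = a) :: int)
    = of_bool (v = a) - of_bool (v = b)"
    using 1(2) assms(1) by (simp add: sum_subtractf of_bool_conj flip: sum_distrib_left)
  then show ?case using 1 by (simp add: excess_def sum.distrib)
qed (auto simp: excess_def)

text \<open>By skew symmetry the flow between vertices of \<open>X\<close> cancels in pairs.\<close>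

lemma sum_excess:
  assumes "finite V" "unit_flow E f" "X \<subseteq> V"
  shows "(\<Sum>v\<in>X. excess V f v) = (\<Sum>v\<in>X. \<Sum>u\<in>V - X. f v u)"
proof -
  have "(\<Sum>v\<in>X. \<Sum>u\<in>X. f v u) = (\<Sum>u\<in>X. \<Sum>v\<in>X. f v u)" by (rule sum.swap)
  also have "\<dots> = - (\<Sum>u\<in>X. \<Sum>v\<in>X. f u v)"
  proof -
    have "f v u = - f u v" for u v using assms(2) unfolding unit_flow_def by blast
    then have "(\<Sum>u\<in>X. \<Sum>v\<in>X. f v u) = (\<Sum>u\<in>X. \<Sum>v\<in>X. - f u v)"
      by (intro sum.cong refl)
    then show ?thesis by (simp only: sum_negf)
  qed
  finally have "(\<Sum>v\<in>X. \<Sum>u\<in>X. f v u) = 0" by simp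
  moreover have "excess V f v = (\<Sum>u\<in>V - X. f v u) + (\<Sum>u\<in>X. f v u)" for v
    unfolding excess_def using assms by (intro sum.subset_diff) auto
  ultimately show ?thesis by (simp add: sum.distrib)
qed

section \<open>Flows between two vertex sets: augmentation and decomposition\<close>

definition st_flow ::
    "'a set \<Rightarrow> 'a set set \<Rightarrow> 'a set \<Rightarrow> 'a set \<Rightarrow> nat \<Rightarrow> ('a \<Rightarrow> 'a \<Rightarrow> int) \<Rightarrow> bool" where
  "st_flow V E S T k f \<longleftrightarrow> unit_flow E f \<and> (\<forall>v\<in>V - S - T. excess V f v = 0) \<and>
     (\<Sum>v\<in>S. excess V f v) = int k"

text \<open>Vertices of \<open>X - S\<close> lie outside \<open>T\<close> and conserve flow, so they
  add nothing to the total excess of \<open>S\<close>.\<close>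

lemma st_flow_across:
  assumes "finite V" "st_flow V E S T k f" "S \<subseteq> X" "X \<subseteq> V - T"
  shows "int k = (\<Sum>v\<in>X. \<Sum>u\<in>V - X. f v u)"
proof -
  have "int k = (\<Sum>v\<in>S. excess V f v)" using assms(2) unfolding st_flow_def by simp
  also have "\<dots> = (\<Sum>v\<in>X. excess V f v)"
    using assms by (intro sum.mono_neutral_left) (auto simp: st_flow_def intro: finite_subset)
  also have "\<dots> = (\<Sum>v\<in>X. \<Sum>u\<in>V - X. f v u)"
    using assms unfolding st_flow_def by (intro sum_excess) auto
  finally show ?thesis .
qed

text \<open>Used with \<open>c = 1\<close> to augment a flow and with \<open>c = -1\<close> to peel
  a path off it.\<close>

lemma st_flow_add_path:
  assumes "finite V" "st_flow V E S T k f" and ST: "S \<subseteq> V" "S \<inter> T = {}"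
    and p: "p \<noteq> []" "set p \<subseteq> V" "hd p \<in> S" "last p \<in> T"
    and flow: "unit_flow E (\<lambda>u v. f u v + c * path_flow p u v)" and "int k' = int k + c"
  shows "st_flow V E S T k' (\<lambda>u v. f u v + c * path_flow p u v)"
proof -
  let ?g = "\<lambda>u v. f u v + c * path_flow p u v"
  have ex: "excess V ?g v = excess V f v + c * (of_bool (v = hd p) - of_bool (v = last p))" for v
    using excess_path_flow[OF assms(1) p(2,1), of v]
    unfolding excess_def by (simp add: sum.distrib flip: sum_distrib_left)
  have "finite S" using assms(1) ST(1) by (rule rev_finite_subset)
  moreover have "last p \<notin> S" using p ST by auto
  ultimately have "(\<Sum>v\<in>S. of_bool (v = hd p) - of_bool (v = last p) :: int) = 1"
    using p by (simp add: sum_subtractf of_bool_def)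
  then have "(\<Sum>v\<in>S. excess V ?g v) = int k'"
    using assms(2,10) unfolding ex st_flow_def
    by (simp add: sum.distrib flip: sum_distrib_left)
  moreover have "excess V ?g v = 0" if "v \<in> V - S - T" for v
    using assms(2) that p unfolding ex st_flow_def by auto
  ultimately show ?thesis using flow unfolding st_flow_def by blast
qed

lemma st_flow_augment:
  assumes G: "simple_graph V E" and f: "st_flow V E S T k f" and ST: "S \<subseteq> V" "S \<inter> T = {}"
    and p: "distinct p" "p \<noteq> []" "hd p \<in> S" "last p \<in> T"
    and res: "successively (\<lambda>u v. {u, v} \<in> E \<and> f u v < 1) p"
  shows "\<exists>g. st_flow V E S T (Suc k) g"
proof -
  have finV: "finite V" using G unfolding simple_graph_def by simp
  have uf: "unit_flow E f" using f unfolding st_flow_def by simp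
  note cases = path_flow_cases[OF p(1) res]
  have "successively (\<lambda>u v. {u, v} \<in> E) p" using res by (rule successively_mono) auto
  then have "set p \<subseteq> V" using p ST(1) by (intro walk_subset_vertices[OF G]) auto
  moreover have "unit_flow E (\<lambda>u v. f u v + 1 * path_flow p u v)"
  proof -
    \<comment> \<open>Values are integers, so residual \<open>f u v < 1\<close> leaves room for a
      whole unit; this includes undoing flow from \<open>v\<close> to \<open>u\<close>.\<close>
    have "f u v + path_flow p u v \<le> 1" for u v
      using cases[of u v] uf unfolding unit_flow_def by (smt (verit))
    moreover have "f u v + path_flow p u v = 0" if "{u, v} \<notin> E" for u v
      using cases[of u v] uf that unfolding unit_flow_def by (smt (verit) insert_commute)
    moreover have "f v u + path_flow p v u = - (f u v + path_flow p u v)" for u v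
      using path_flow_skew[of p v u] uf unfolding unit_flow_def by (smt (verit))
    ultimately show ?thesis unfolding unit_flow_def mult_1 by (intro conjI allI impI)
  qed
  ultimately have "st_flow V E S T (Suc k) (\<lambda>u v. f u v + 1 * path_flow p u v)"
    using p by (intro st_flow_add_path[OF finV f ST]) auto
  then show ?thesis by blast
qed

lemma card_cut_eq_sum:
  assumes G: "simple_graph V E" and "X \<subseteq> V"
  shows "int (card (cut E X)) = (\<Sum>v\<in>X. \<Sum>u\<in>V - X. of_bool ({v, u} \<in> E))"
proof -
  have fin: "finite V" "finite X" using G assms(2) unfolding simple_graph_def
    by (auto dest: finite_subset)
  let ?A = "{(v, u). v \<in> X \<and> u \<in> V - X \<and> {v, u} \<in> E}"
  have "bij_betw (\<lambda>(v, u). {v, u}) ?A (cut E X)"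
  proof (rule bij_betwI')
    fix e assume "e \<in> cut E X"
    then obtain x where x: "e \<in> E" "x \<in> e" "x \<in> X" "\<not> e \<subseteq> X" unfolding cut_def by auto
    then obtain y where y: "e = {x, y}" using simple_graph_neighbour[OF G] by blast
    have "(x, y) \<in> ?A" using x y simple_graph_edgeD[OF G] by auto
    then show "\<exists>a\<in>?A. e = (\<lambda>(v, u). {v, u}) a" using y by force
  qed (auto simp: cut_def doubleton_eq_iff)
  then have "card (cut E X) = card ?A" by (simp add: bij_betw_same_card)
  also have "?A = (SIGMA v:X. {u \<in> V - X. {v, u} \<in> E})" by auto
  also have "card \<dots> = (\<Sum>v\<in>X. card {u \<in> V - X. {v, u} \<in> E})"
    using fin by (intro card_SigmaI) auto
  finally show ?thesis using fin by (simp add: Int_def conj_commute)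
qed

text \<open>Ford-Fulkerson: the value is raised one unit at a time. If no residual path reaches
  \<open>T\<close>, all edges leaving the reachable set are saturated, so the current value is the
  size of a cut, hence at least \<open>k\<close>.\<close>

lemma st_flow_exists:
  assumes G: "simple_graph V E" and ST: "S \<subseteq> V" "T \<subseteq> V" "S \<inter> T = {}"
    and cuts: "\<And>X. S \<subseteq> X \<Longrightarrow> X \<subseteq> V - T \<Longrightarrow> k \<le> card (cut E X)"
  shows "\<exists>f. st_flow V E S T k f"
proof -
  have finV: "finite V" using G unfolding simple_graph_def by simp
  have "j \<le> k \<Longrightarrow> \<exists>f. st_flow V E S T j f" for j
  proof (induction j)
    case 0
    show ?case
      by (rule exI[of _ "\<lambda>_ _. 0"]) (auto simp: st_flow_def unit_flow_def excess_def)
  next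
    case (Suc j)
    then obtain f where f: "st_flow V E S T j f" by auto
    let ?R = "\<lambda>u v. {u, v} \<in> E \<and> f u v < 1"
    let ?X = "{(u, v). ?R u v}\<^sup>* `` S"
    have XV: "?X \<subseteq> V"
    proof
      fix v assume "v \<in> ?X"
      then obtain s where "s \<in> S" "(s, v) \<in> {(u, v). ?R u v}\<^sup>*" by auto
      from this(2) show "v \<in> V"
        by (cases rule: rtranclE) (use \<open>s \<in> S\<close> ST simple_graph_edgeD[OF G] in auto)
    qed
    show ?case
    proof (cases "?X \<inter> T = {}")
      case True
      have edge: "f v u = of_bool ({v, u} \<in> E)" if "v \<in> ?X" "u \<in> V - ?X" for v u
      proof -
        have "\<not> ?R v u"
        proof
          assume "?R v u"
          then have "u \<in> ?X" using that(1) by (auto intro: rtrancl_into_rtrancl)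
          with that(2) show False by simp
        qed
        moreover have "f v u \<le> 1" "{v, u} \<notin> E \<Longrightarrow> f v u = 0"
          using f unfolding st_flow_def unit_flow_def by blast+
        ultimately show ?thesis by auto
      qed
      have X: "S \<subseteq> ?X" "?X \<subseteq> V - T" using XV True by auto
      have "int j = (\<Sum>v\<in>?X. \<Sum>u\<in>V - ?X. f v u)"
        using st_flow_across[OF finV f X] .
      also have "\<dots> = (\<Sum>v\<in>?X. \<Sum>u\<in>V - ?X. of_bool ({v, u} \<in> E))"
        using edge by (intro sum.cong refl) auto
      also have "\<dots> = int (card (cut E ?X))" using card_cut_eq_sum[OF G XV] by simp
      finally show ?thesis using cuts[OF X] Suc.prems by simp
    next
      case False
      then obtain s t where st: "s \<in> S" "t \<in> T" "(s, t) \<in> {(u, v). ?R u v}\<^sup>*" by auto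
      obtain p where "p \<noteq> []" "distinct p" "successively ?R p" "hd p = s" "last p = t"
        using rtrancl_imp_distinct_chain[OF st(3)] by blast
      then show ?thesis using st_flow_augment[OF G f ST(1,3), of p] st by blast
    qed
  qed
  then show ?thesis by blast
qed

text \<open>Paths of edges carrying flow are peeled off one by one. The support clause strengthens
  the induction: later paths avoid the edges whose flow has been cancelled.\<close>

lemma st_flow_decompose:
  assumes G: "simple_graph V E" and ST: "S \<subseteq> V" "T \<subseteq> V" "S \<inter> T = {}"
    and "st_flow V E S T k f"
  shows "\<exists>P. finite P \<and> card P = k \<and> edge_disjoint P \<and>
    (\<forall>p\<in>P. is_path V E p \<and> hd p \<in> S \<and> last p \<in> T \<and>
       (\<forall>u v. {u, v} \<in> set (walk_edges p) \<longrightarrow> f u v \<noteq> 0))"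
  using assms(5)
proof (induction k arbitrary: f)
  case 0
  show ?case by (rule exI[of _ "{}"]) (auto simp: edge_disjoint_def)
next
  case (Suc k)
  have finV: "finite V" using G unfolding simple_graph_def by simp
  have uf: "unit_flow E f" using Suc.prems unfolding st_flow_def by simp
  then have skew: "f v u = - f u v" and le1: "f u v \<le> 1" for u v unfolding unit_flow_def by blast+
  have supp: "{u, v} \<in> E" if "f u v \<noteq> 0" for u v using uf that unfolding unit_flow_def by blast
  let ?R = "\<lambda>u v. f u v = 1"
  let ?X = "{(u, v). ?R u v}\<^sup>* `` S"
  have XV: "?X \<subseteq> V"
  proof
    fix v assume "v \<in> ?X"
    then obtain s where "s \<in> S" "(s, v) \<in> {(u, v). ?R u v}\<^sup>*" by auto
    from this(2) show "v \<in> V"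
    proof (cases rule: rtranclE)
      case (step y)
      then have "{y, v} \<in> E" by (intro supp) simp
      then show ?thesis by (rule simple_graph_edgeD[OF G])
    qed (use \<open>s \<in> S\<close> ST in auto)
  qed
  \<comment> \<open>Otherwise no positive flow would leave \<open>?X\<close>, contradicting the
    value \<open>Suc k\<close>.\<close>
  have "?X \<inter> T \<noteq> {}"
  proof
    assume "?X \<inter> T = {}"
    then have X: "S \<subseteq> ?X" "?X \<subseteq> V - T" using XV by auto
    have "f v u \<le> 0" if "v \<in> ?X" "u \<in> V - ?X" for v u
    proof -
      have "\<not> ?R v u"
      proof
        assume "?R v u"
        then have "u \<in> ?X" using that(1) by (auto intro: rtrancl_into_rtrancl)
        with that(2) show False by simp
      qed
      with le1[of v u] show ?thesis by simp
    qed
    then have "(\<Sum>v\<in>?X. \<Sum>u\<in>V - ?X. f v u) \<le> 0" by (intro sum_nonpos) auto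
    with st_flow_across[OF finV Suc.prems X] show False by simp
  qed
  then obtain s t where st: "s \<in> S" "t \<in> T" "(s, t) \<in> {(u, v). ?R u v}\<^sup>*" by auto
  obtain p where p: "p \<noteq> []" "distinct p" "successively ?R p" "hd p = s" "last p = t"
    using rtrancl_imp_distinct_chain[OF st(3)] by blast
  note cases = path_flow_cases[OF p(2,3)]
  have pE: "set (walk_edges p) \<subseteq> E"
    unfolding walk_edges_subset_iff using p(3)
    by (rule successively_mono) (use supp in auto)
  have pV: "set p \<subseteq> V"
    using pE p(1,4) st(1) ST(1) unfolding walk_edges_subset_iff
    by (intro walk_subset_vertices[OF G]) auto
  let ?g = "\<lambda>u v. f u v + (- 1) * path_flow p u v"
  have g0: "?g u v = 0" if "{u, v} \<in> set (walk_edges p)" for u v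
    using cases[of u v] that skew[of u v] by auto
  have gf: "?g u v = f u v" if "{u, v} \<notin> set (walk_edges p)" for u v
    using cases[of u v] that by auto
  have "unit_flow E ?g"
  proof -
    have "?g u v \<le> 1" "{u, v} \<notin> E \<Longrightarrow> ?g u v = 0" for u v
      using g0[of u v] gf[of u v] le1[of u v] supp[of u v] by fastforce+
    moreover have "?g v u = - ?g u v" for u v
      using path_flow_skew[of p v u] skew[of v u] by simp
    ultimately show ?thesis unfolding unit_flow_def by blast
  qed
  then have "st_flow V E S T k ?g"
    using st_flow_add_path[OF finV Suc.prems ST(1,3) p(1) pV, of "- 1" k] p st by simp
  from Suc.IH[OF this] obtain P where P: "finite P" "card P = k" "edge_disjoint P"
    and P': "\<And>q. q \<in> P \<Longrightarrow> is_path V E q \<and> hd q \<in> S \<and> last q \<in> T \<and>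
      (\<forall>u v. {u, v} \<in> set (walk_edges q) \<longrightarrow> ?g u v \<noteq> 0)"
    by blast
  have disj: "disjnt (set (walk_edges p)) (set (walk_edges q))" if "q \<in> P" for q
    unfolding disjnt_iff
  proof (intro allI notI, elim conjE)
    fix e assume e: "e \<in> set (walk_edges p)" "e \<in> set (walk_edges q)"
    then have "card e = 2" using pE G unfolding simple_graph_def by blast
    then obtain u v where "e = {u, v}" by (meson card_2_iff)
    then show False using e g0[of u v] P'[OF that] by blast
  qed
  \<comment> \<open>Disjointness from all of \<open>P\<close> excludes \<open>p\<close> from
    \<open>P\<close> only because \<open>p\<close> has an edge; then the cardinality really
    grows.\<close>
  have "set (walk_edges p) \<noteq> {}"
  proof -
    have "hd p \<noteq> last p" using st ST(3) p by auto
    then show ?thesis using p(1) by (cases p rule: walk_edges.cases) auto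
  qed
  then have "p \<notin> P" using disj[of p] by (auto simp: disjnt_def)
  then have "card (insert p P) = Suc k" using P by simp
  moreover have "edge_disjoint (insert p P)"
    using P(3) disj unfolding edge_disjoint_def pairwise_insert by (auto simp: disjnt_sym)
  moreover have "f u v \<noteq> 0" if "{u, v} \<in> set (walk_edges p)" for u v
    using cases[of u v] that skew[of u v] by auto
  moreover have "f u v \<noteq> 0" if "?g u v \<noteq> 0" for u v
    using g0[of u v] gf[of u v] that by fastforce
  moreover have "is_path V E p"
    unfolding is_path_def is_walk_def using p pE pV by blast
  ultimately show ?case
    using P P' p st by (intro exI[of _ "insert p P"]) (auto split: if_splits)
qed

theorem edge_menger:
  assumes "simple_graph V E" and "S \<subseteq> V" "T \<subseteq> V" "S \<inter> T = {}"
    and "\<And>X. S \<subseteq> X \<Longrightarrow> X \<subseteq> V - T \<Longrightarrow> k \<le> card (cut E X)"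
  shows "\<exists>P. finite P \<and> card P = k \<and> edge_disjoint P \<and>
    (\<forall>p\<in>P. is_path V E p \<and> hd p \<in> S \<and> last p \<in> T)"
proof -
  obtain f where "st_flow V E S T k f" using st_flow_exists[OF assms] by blast
  from st_flow_decompose[OF assms(1-4) this] show ?thesis by blast
qed

section \<open>Odd ears\<close>

text \<open>At an inner vertex of \<open>S\<close> or \<open>T\<close> the path is split and the
  half still running from \<open>S\<close> to \<open>T\<close> is kept: the first half for a vertex
  of \<open>T\<close>, the second for one of \<open>S\<close>.\<close>

lemma path_contains_ear:
  assumes "is_path V E p" "hd p \<in> S" "last p \<in> T"
  shows "\<exists>q. is_path V E q \<and> hd q \<in> S \<and> last q \<in> T \<and> set (butlast (tl q)) \<inter> (S \<union> T) = {} \<and>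
    set (walk_edges q) \<subseteq> set (walk_edges p)"
  using assms
proof (induction "length p" arbitrary: p rule: less_induct)
  case less
  show ?case
  proof (cases "set (butlast (tl p)) \<inter> (S \<union> T) = {}")
    case True
    then show ?thesis using less.prems by blast
  next
    case False
    then obtain x where x: "x \<in> set (butlast (tl p))" "x \<in> S \<union> T" by auto
    obtain a q where p: "p = a # q" using x by (cases p) auto
    obtain q1 q2 where q12: "butlast q = q1 @ x # q2" using x p by (auto dest: split_list)
    then have "q \<noteq> []" by auto
    then have q: "q = q1 @ x # q2 @ [last q]" using q12 by (metis append_butlast_last_id append.assoc append_Cons)
    let ?p1 = "(a # q1) @ [x]" and ?p2 = "x # q2 @ [last q]"
    have pp: "p = (a # q1) @ x # (q2 @ [last q])" using p q by simp
    have we: "set (walk_edges p) = set (walk_edges ?p1) \<union> set (walk_edges ?p2)"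
      unfolding pp walk_edges_append[of "a # q1" x "q2 @ [last q]"] by simp
    have path: "is_path V E ?p1" "is_path V E ?p2"
      using less.prems(1) we unfolding is_path_def is_walk_def pp by auto
    have len: "length ?p1 < length p" "length ?p2 < length p" unfolding pp by auto
    have ends: "hd ?p1 = hd p" "last ?p2 = last p" unfolding pp by auto
    from x(2) show ?thesis
    proof
      assume "x \<in> T"
      then have "hd ?p1 \<in> S" "last ?p1 \<in> T" using less.prems ends by auto
      from less.hyps[OF len(1) path(1) this] show ?thesis using we by blast
    next
      assume "x \<in> S"
      then have "hd ?p2 \<in> S" "last ?p2 \<in> T" using less.prems ends by auto
      from less.hyps[OF len(2) path(2) this] show ?thesis using we by blast
    qed
  qed
qed

lemma bipartite_walk_parity:
  assumes "A \<inter> B = {}" "\<forall>e\<in>E. \<exists>a\<in>A. \<exists>b\<in>B. e = {a, b}"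
    and "set (walk_edges p) \<subseteq> E" "p \<noteq> []" "hd p \<in> A \<union> B"
  shows "odd (length (walk_edges p)) \<longleftrightarrow> (hd p \<in> A) \<noteq> (last p \<in> A)"
  using assms(3-)
proof (induction p rule: walk_edges.induct)
  case (1 u v p)
  obtain a b where "a \<in> A" "b \<in> B" "{u, v} = {a, b}" using assms(2) 1(2) by auto
  then have "(u \<in> A) \<noteq> (v \<in> A)" "v \<in> A \<union> B"
    using assms(1) by (auto simp: doubleton_eq_iff)
  then show ?case using 1 by auto
qed auto

section \<open>One colour class of a distance matching\<close>

lemma transversal_far:
  assumes "simple_graph V E" and dm: "distance_matching V E d M"
    and A: "\<And>e. e \<in> M \<Longrightarrow> card (e \<inter> A) = 1"
    and p: "successively (\<lambda>u v. {u, v} \<in> E) p" "p \<noteq> []"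
    and ends: "hd p \<in> \<Union>M \<inter> A" "last p \<in> \<Union>M \<inter> A" "hd p \<noteq> last p"
  shows "d < length p"
proof -
  obtain q where q: "q \<noteq> []" "distinct q" "successively (\<lambda>u v. {u, v} \<in> E) q" "hd q = hd p"
    "last q = last p" "length q \<le> length p"
    using successively_distinct[OF p(2,1)] by blast
  obtain e f where ef: "e \<in> M" "hd q \<in> e" "f \<in> M" "last q \<in> f" using ends q by auto
  have "M \<subseteq> E" using dm unfolding distance_matching_def matching_def by simp
  then have "hd q \<in> V" using ef assms(1) unfolding simple_graph_def by blast
  with q(1,3) have "set q \<subseteq> V" by (intro walk_subset_vertices[OF assms(1)])
  then have path: "is_path V E q"
    unfolding is_path_def is_walk_def walk_edges_subset_iff using q by blast
  \<comment> \<open>A matching edge has only one vertex in \<open>A\<close>, so distinct ends in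
    \<open>A\<close> belong to distinct matching edges.\<close>
  have "e \<noteq> f"
  proof
    assume "e = f"
    then have "{hd q, last q} \<subseteq> e \<inter> A" using ef ends q by auto
    moreover obtain z where "e \<inter> A = {z}" using A[OF ef(1)] by (meson card_1_singletonE)
    ultimately show False using ends(3) q by auto
  qed
  then have "enat d \<le> edge_distance V E e f"
    using dm ef unfolding distance_matching_def by blast
  also have "\<dots> \<le> enat (length (walk_edges q))"
    unfolding edge_distance_def using path ef by (intro Inf_lower) blast
  finally have "d \<le> length q - 1" by (simp add: length_walk_edges)
  then show ?thesis using q by (cases q) auto
qed

lemma card_transversal:
  assumes "finite M" "pairwise disjnt M" "\<And>e. e \<in> M \<Longrightarrow> card (e \<inter> A) = 1"
  shows "card (\<Union>M \<inter> A) = card M"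
proof -
  have "\<Union>M \<inter> A = (\<Union>e\<in>M. e \<inter> A)" by auto
  also have "card \<dots> = (\<Sum>e\<in>M. card (e \<inter> A))"
  proof (intro card_UN_disjoint ballI impI)
    show "finite (e \<inter> A)" if "e \<in> M" for e using assms(3)[OF that] by (simp add: card_ge_0_finite)
    show "(e \<inter> A) \<inter> (f \<inter> A) = {}" if "e \<in> M" "f \<in> M" "e \<noteq> f" for e f
      using assms(2) that unfolding pairwise_def disjnt_def by blast
  qed (use assms in auto)
  finally show ?thesis using assms(3) by simp
qed

text \<open>The acyclic bound with \<open>W\<close> the transversal is combined with the degree
  count of \<open>card_cut\<close>. As \<open>A\<close> is arbitrary, the lemma serves both colour
  classes.\<close>

lemma transversal_cut:
  assumes G: "simple_graph V E" and "regular V E r" and "r \<ge> 3" "d \<ge> 3" "r \<ge> 4 \<or> d \<ge> 5"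
    and dm: "distance_matching V E d M" and A: "\<And>e. e \<in> M \<Longrightarrow> card (e \<inter> A) = 1"
    and X: "\<Union>M \<inter> A \<subseteq> X" "X \<subseteq> V" and acyclic: "\<nexists>c. is_cycle V E c \<and> set c \<subseteq> X"
  shows "card M * r \<le> card (cut E X)"
proof -
  have M: "M \<subseteq> E" "pairwise disjnt M"
    using dm unfolding distance_matching_def matching_def by auto
  have "finite M" using M(1) simple_graph_finite_edges[OF G] by (rule finite_subset)
  then have card: "card (\<Union>M \<inter> A) = card M" using M(2) A by (rule card_transversal)
  have "r * card (\<Union>M \<inter> A) + 2 * card (induced E X) \<le> r * card X"
    using transversal_far[OF G dm A] by (intro acyclic_edge_bound[OF G assms(3-5) X(2,1) acyclic]) blast+
  then show ?thesis using card_cut[OF G assms(2) X(2)] unfolding card by (simp add: mult.commute)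
qed

theorem lemma1:
  fixes V :: "'a set" and E M :: "'a set set" and d m r :: nat
  assumes "d \<ge> 3" and "r \<ge> 3"
    and "simple_graph V E" and "regular V E r" and "bipartite V E"
    and "distance_matching V E d M" and "card M = m"
    and "(r, d) \<noteq> (3, 3)" and "(r, d) \<noteq> (3, 4)"
  shows "\<exists>P. finite P \<and> (\<forall>p\<in>P. odd_ear V E (\<Union>M) p) \<and> edge_disjoint P \<and>
           enat (card P) = min (cyclic_edge_connectivity V E) (enat (m * r))"
proof -
  note G = \<open>simple_graph V E\<close>
  have rd: "r \<ge> 4 \<or> d \<ge> 5" using assms by auto
  obtain A B where AB: "A \<union> B = V" "A \<inter> B = {}" "\<forall>e\<in>E. \<exists>a\<in>A. \<exists>b\<in>B. e = {a, b}"
    using assms(5) unfolding bipartite_def by blast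
  have ME: "M \<subseteq> E" using assms(6) unfolding distance_matching_def matching_def by simp
  have one: "card (e \<inter> A) = 1" "card (e \<inter> B) = 1" if "e \<in> M" for e
  proof -
    have "e \<in> E" using ME that by auto
    then obtain a b where "a \<in> A" "b \<in> B" "e = {a, b}" using AB(3) by blast
    then have "e \<inter> A = {a}" "e \<inter> B = {b}" using AB(2) by auto
    then show "card (e \<inter> A) = 1" "card (e \<inter> B) = 1" by auto
  qed
  define S T where "S = \<Union>M \<inter> A" and "T = \<Union>M \<inter> B"
  have ST: "S \<subseteq> V" "T \<subseteq> V" "S \<inter> T = {}" unfolding S_def T_def using AB by auto
  have U: "\<Union>M = S \<union> T"
    unfolding S_def T_def using ME G AB(1) unfolding simple_graph_def by blast
  \<comment> \<open>The minimum is finite even when there is no cyclic edge cut.\<close>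
  obtain k where k: "enat k = min (cyclic_edge_connectivity V E) (enat (m * r))"
    by (metis enat_ile min.cobounded2)
  have cuts: "k \<le> card (cut E X)" if X: "S \<subseteq> X" "X \<subseteq> V - T" for X
  proof (cases "m * r \<le> card (cut E X)")
    case True
    moreover have "k \<le> m * r" using k by (metis enat_ord_simps(1) min.cobounded2)
    ultimately show ?thesis by simp
  next
    case False
    \<comment> \<open>A cut with fewer than \<open>m * r\<close> edges has a cycle on each side, by
      contraposition of \<open>transversal_cut\<close>.\<close>
    have "\<exists>c. is_cycle V E c \<and> set c \<subseteq> X"
      using transversal_cut[OF G assms(4,2,1) rd assms(6) one(1), of X] X assms(7) False
      unfolding S_def by blast
    moreover have "\<exists>c. is_cycle V E c \<and> set c \<subseteq> V - X"
      using transversal_cut[OF G assms(4,2,1) rd assms(6) one(2), of "V - X"] X ST(2) assms(7) False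
      unfolding T_def cut_complement[OF G] by blast
    ultimately have "cyclic_edge_cut V E (cut E X)" using cyclic_edge_cut_cut[OF G] by blast
    then have "cyclic_edge_connectivity V E \<le> enat (card (cut E X))"
      unfolding cyclic_edge_connectivity_def by (intro Inf_lower) blast
    then show ?thesis using k by (metis enat_ord_simps(1) min.coboundedI1)
  qed
  obtain P where P: "finite P" "card P = k" "edge_disjoint P"
    and path: "\<And>p. p \<in> P \<Longrightarrow> is_path V E p \<and> hd p \<in> S \<and> last p \<in> T"
    using edge_menger[OF G ST cuts] by blast
  obtain h where h: "\<And>p. p \<in> P \<Longrightarrow> is_path V E (h p) \<and> hd (h p) \<in> S \<and> last (h p) \<in> T \<and>
    set (butlast (tl (h p))) \<inter> (S \<union> T) = {} \<and> set (walk_edges (h p)) \<subseteq> set (walk_edges p)"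
    using path_contains_ear path by metis
  have odd: "odd (length (walk_edges (h p)))" if "p \<in> P" for p
    using h[OF that] bipartite_walk_parity[OF AB(2,3), of "h p"] AB(2)
    unfolding is_path_def is_walk_def S_def T_def by blast
  have disj: "disjnt (set (walk_edges (h p))) (set (walk_edges (h q)))"
    if "p \<in> P" "q \<in> P" "p \<noteq> q" for p q
    using P(3) that h[OF that(1)] h[OF that(2)] unfolding edge_disjoint_def pairwise_def
    by (meson disjnt_subset1 disjnt_subset2)
  \<comment> \<open>Distinct paths with the same ear would make it edge-disjoint from itself, yet an
    odd ear has an edge.\<close>
  have "inj_on h P"
  proof (rule inj_onI, rule ccontr)
    fix p q assume "p \<in> P" "q \<in> P" "h p = h q" "p \<noteq> q"
    then show False using disj[of p q] odd[of p] by (auto simp: disjnt_def)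
  qed
  then have "card (h ` P) = k" using P by (simp add: card_image)
  moreover have "edge_disjoint (h ` P)"
    unfolding edge_disjoint_def pairwise_def using disj by blast
  moreover have "odd_ear V E (\<Union>M) p" if "p \<in> h ` P" for p
    unfolding odd_ear_def ear_def U using that h odd by blast
  ultimately show ?thesis using P(1) k by (intro exI[of _ "h ` P"]) auto
qed

end
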